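(* Let $(A,+,0)$ be a partial abelian monoid and let $\sim\,\subseteq A\times A$ be a relation satisfying the following conditions: \begin{itemize} \item[(C1)] $\sim$ is an equivalence relation. \item[(C2)] For all $x_1,x_2,y_1,y_2\in A$: if $x_1+y_1$ exists, $x_2+y_2$ exists, $x_1\sim x_2$ and $y_1\sim y_2$, then $x_1+y_1\sim x_2+y_2$. \item[(C5)] For all $x,y,z\in A$: if $x+y$ exists and $(x+y)\sim z$, then there are $x_1,y_1\in A$ such that $x_1\sim x$, $y_1\sim y$, $x_1+y_1$ exists and $x_1+y_1=z$. \item For all $x\in A$: $x\sim 0$ implies $x=0$. \end{itemize} Then the quotient map $f\colon A\to A/{\sim}$ given by $f(x)=[x]_{\sim}$ is a left adjoint in $\mathbf{RelMon}$, and $\sim\,=f^{\dagger}\circ f$. Here $A$ and $A/{\sim}$ are partial abelian monoids regarded as relational monoids.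
   Context: Relations: a relation $f\colon A\to B$ is a subset $f\subseteq A\times B$; $(a,c)\in g\circ f$ iff there is $b$ with $(a,b)\in f$ and $(b,c)\in g$; $\mathrm{id}_A=\{(a,a):a\in A\}$; $f^{\dagger}=\{(b,a):(a,b)\in f\}$. Mappings are identified with their graphs. A relational monoid is a set $A$ with a subset $E_A\subseteq A$ (the units) and a relation $*\subseteq (A\times A)\times A$, where $(a_1,a_2)\xmapsto{*}a$ means $((a_1,a_2),a)\in *$, such that: (right unit) for each $a\in A$ there is $y\in E_A$ with $(a,y)\xmapsto{*}a$, and whenever $y\in E_A$ and $(a,y)\xmapsto{*}b$ then $a=b$; (left unit) for each $a\in A$ there is $y\in E_A$ with $(y,a)\xmapsto{*}a$, and whenever $y\in E_A$ and $(y,a)\xmapsto{*}b$ then $a=b$; (associativity) for all $a_1,a_2,a_3,z\in A$, there is $w$ with $(a_1,a_2)\xmapsto{*}w$ and $(w,a_3)\xmapsto{*}z$ if and only if there is $w'$ with $(a_2,a_3)\xmapsto{*}w'$ and $(a_1,w')\xmapsto{*}z$. A morphism of relational monoids $h\colon A\to B$ is a relation $h\subseteq A\times B$ such that (i) whenever $(a_1,a_2)\xmapsto{*}a$ in $A$ and $(a,b)\in h$, there are $b_1,b_2\in B$ with $(a_1,b_1)\in h$, $(a_2,b_2)\in h$ and $(b_1,b_2)\xmapsto{*}b$ in $B$; (ii) whenever $y\in E_A$ and $(y,b)\in h$, then $b\in E_B$. $\mathbf{RelMon}$ is the 2-category with relational monoids as 0-cells, these morphisms as 1-cells, and inclusions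 of relations as 2-cells. A morphism $f\colon A\to B$ in $\mathbf{RelMon}$ is a left adjoint if there is a morphism $g\colon B\to A$ in $\mathbf{RelMon}$ with $\mathrm{id}_A\subseteq g\circ f$ and $f\circ g\subseteq\mathrm{id}_B$. A partial abelian monoid is a set $P$ with an element $0$ and a binary partial operation $+$ (write $a\perp b$ when $a+b$ is defined) such that for all $a,b,c\in P$: (P1) $b\perp c$ and $a\perp b+c$ imply $a\perp b$, $a+b\perp c$ and $a+(b+c)=(a+b)+c$; (P2) $a\perp b$ implies $b\perp a$ and $a+b=b+a$; (P3) $a\perp 0$ and $a+0=a$. It is regarded as a relational monoid with $E_P=\{0\}$ and $(a,b)\xmapsto{*}c$ iff $a\perp b$ and $a+b=c$. Under (C1), (C2), (C5), the quotient set $A/{\sim}$ carries the partial operation defined as follows: $[x]_{\sim}+[y]_{\sim}$ exists iff there are $x_1\sim x$ and $y_1\sim y$ such that $x_1+y_1$ exists, and then $[x]_{\sim}+[y]_{\sim}=[x_1+y_1]_{\sim}$. It is a known result (Chevalier and Pulmannová) that this is well defined and that $(A/{\sim},+,[0]_{\sim})$ is a partial abelian monoid. *)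

theory Defs
  imports Main
begin

record 'a rel_monoid =
  elems :: "'a set"
  units :: "'a set"
  mult :: "(('a \<times> 'a) \<times> 'a) set"

definition relational_monoid :: "'a rel_monoid \<Rightarrow> bool" where
  "relational_monoid A \<longleftrightarrow>
     units A \<subseteq> elems A \<and>
     mult A \<subseteq> (elems A \<times> elems A) \<times> elems A \<and>
     (\<forall>a\<in>elems A. \<exists>y\<in>units A. ((a, y), a) \<in> mult A) \<and>
     (\<forall>a\<in>elems A. \<forall>b\<in>elems A. \<forall>y\<in>units A. ((a, y), b) \<in> mult A \<longrightarrow> a = b) \<and>
     (\<forall>a\<in>elems A. \<exists>y\<in>units A. ((y, a), a) \<in> mult A) \<and>
     (\<forall>a\<in>elems A. \<forall>b\<in>elems A. \<forall>y\<in>units A. ((y, a), b) \<in> mult A \<longrightarrow> a = b) \<and>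
     (\<forall>a\<^sub>1\<in>elems A. \<forall>a\<^sub>2\<in>elems A. \<forall>a\<^sub>3\<in>elems A. \<forall>z\<in>elems A.
        (\<exists>w\<in>elems A. ((a\<^sub>1, a\<^sub>2), w) \<in> mult A \<and> ((w, a\<^sub>3), z) \<in> mult A) \<longleftrightarrow>
        (\<exists>w'\<in>elems A. ((a\<^sub>2, a\<^sub>3), w') \<in> mult A \<and> ((a\<^sub>1, w'), z) \<in> mult A))"

(* The 1-cells of RelMon; that A and B are 0-cells is part of the predicate. *)
definition relmon_morphism ::
    "'a rel_monoid \<Rightarrow> 'b rel_monoid \<Rightarrow> ('a \<times> 'b) set \<Rightarrow> bool" where
  "relmon_morphism A B h \<longleftrightarrow>
     relational_monoid A \<and> relational_monoid B \<and>
     h \<subseteq> elems A \<times> elems B \<and>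
     (\<forall>a\<^sub>1 a\<^sub>2 a b. ((a\<^sub>1, a\<^sub>2), a) \<in> mult A \<and> (a, b) \<in> h \<longrightarrow>
        (\<exists>b\<^sub>1\<in>elems B. \<exists>b\<^sub>2\<in>elems B.
           (a\<^sub>1, b\<^sub>1) \<in> h \<and> (a\<^sub>2, b\<^sub>2) \<in> h \<and> ((b\<^sub>1, b\<^sub>2), b) \<in> mult B)) \<and>
     (\<forall>y b. y \<in> units A \<and> (y, b) \<in> h \<longrightarrow> b \<in> units B)"

(* O composes in diagrammatic order: f O g is the composite "g after f". *)
definition relmon_left_adjoint ::
    "'a rel_monoid \<Rightarrow> 'b rel_monoid \<Rightarrow> ('a \<times> 'b) set \<Rightarrow> bool" where
  "relmon_left_adjoint A B f \<longleftrightarrow>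
     relmon_morphism A B f \<and>
     (\<exists>g. relmon_morphism B A g \<and> Id_on (elems A) \<subseteq> f O g \<and> g O f \<subseteq> Id_on (elems B))"

(* padd P a b = None means that a + b is undefined; values of padd P at arguments
   outside the carrier are irrelevant. *)
record 'a pam =
  carrier :: "'a set"
  zero :: 'a
  padd :: "'a \<Rightarrow> 'a \<Rightarrow> 'a option"

definition partial_abelian_monoid :: "'a pam \<Rightarrow> bool" where
  "partial_abelian_monoid P \<longleftrightarrow>
     zero P \<in> carrier P \<and>
     (\<forall>a\<in>carrier P. \<forall>b\<in>carrier P. \<forall>c. padd P a b = Some c \<longrightarrow> c \<in> carrier P) \<and>
     (\<forall>a\<in>carrier P. \<forall>b\<in>carrier P. \<forall>c\<in>carrier P. \<forall>d e.
        padd P b c = Some d \<and> padd P a d = Some e \<longrightarrow>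
        (\<exists>s. padd P a b = Some s \<and> padd P s c = Some e)) \<and>
     (\<forall>a\<in>carrier P. \<forall>b\<in>carrier P. \<forall>c. padd P a b = Some c \<longrightarrow> padd P b a = Some c) \<and>
     (\<forall>a\<in>carrier P. padd P a (zero P) = Some a)"

definition pam_rel_monoid :: "'a pam \<Rightarrow> 'a rel_monoid" where
  "pam_rel_monoid P =
     \<lparr>elems = carrier P, units = {zero P},
      mult = {((a, b), c). a \<in> carrier P \<and> b \<in> carrier P \<and> c \<in> carrier P \<and>
                           padd P a b = Some c}\<rparr>"

(* The description below determines a unique class when r satisfies (C1) and (C2). *)
definition pam_quotient :: "'a pam \<Rightarrow> ('a \<times> 'a) set \<Rightarrow> 'a set pam" where
  "pam_quotient A r =
     \<lparr>carrier = carrier A // r, zero = r `` {zero A},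
      padd = (\<lambda>X Y.
        if \<exists>x\<^sub>1\<in>X. \<exists>y\<^sub>1\<in>Y. padd A x\<^sub>1 y\<^sub>1 \<noteq> None
        then Some (THE Z. \<exists>x\<^sub>1\<in>X. \<exists>y\<^sub>1\<in>Y. \<exists>s. padd A x\<^sub>1 y\<^sub>1 = Some s \<and> Z = r `` {s})
        else None)\<rparr>"

definition quotient_map :: "'a pam \<Rightarrow> ('a \<times> 'a) set \<Rightarrow> ('a \<times> 'a set) set" where
  "quotient_map A r = {(x, r `` {x}) | x. x \<in> carrier A}"

end

theory Submission
  imports Defs
begin

text \<open>
  The right adjoint of the quotient map \<open>f\<close> is its converse \<open>f\<^sup>\<dagger>\<close>. As \<open>f\<close> is a total
  function, unit and counit hold for any equivalence relation, and \<open>f\<^sup>\<dagger> \<circ> f\<close> is its kernel;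
  what has to be shown is that both relations are morphisms between relational monoids. For \<open>f\<close>
  this says only that representatives that can be added have classes that can be added. For
  \<open>f\<^sup>\<dagger>\<close> one is given \<open>[x] + [y] = [z]\<close> and has to split the \<^emph>\<open>chosen\<close> representative
  \<open>z\<close> into summands equivalent to \<open>x\<close> and \<open>y\<close>, and the only element over the unit \<open>[0]\<close> has to
  be \<open>0\<close>: the first is (C5), the second is the assumption on the class of zero.

  That the quotient is a relational monoid comes from its being a partial abelian monoid. Only
  associativity takes thought, since the representatives of \<open>[b] + [c]\<close> that add to some
  representative of \<open>[a]\<close> need not be sums of the given \<open>b\<close> and \<open>c\<close>; (C5) replaces \<open>b\<close> and \<open>c\<close> by
  equivalent elements for which this is so.
\<close>

lemma pam_zero_carrier: "partial_abelian_monoid P \<Longrightarrow> zero P \<in> carrier P"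
  unfolding partial_abelian_monoid_def by blast

lemma pam_sum_carrier:
  "\<lbrakk>partial_abelian_monoid P; padd P a b = Some c; a \<in> carrier P; b \<in> carrier P\<rbrakk>
    \<Longrightarrow> c \<in> carrier P"
  unfolding partial_abelian_monoid_def by blast

lemma pam_commute:
  "\<lbrakk>partial_abelian_monoid P; padd P a b = Some c; a \<in> carrier P; b \<in> carrier P\<rbrakk>
    \<Longrightarrow> padd P b a = Some c"
  unfolding partial_abelian_monoid_def by blast

lemma pam_add_zero: "\<lbrakk>partial_abelian_monoid P; a \<in> carrier P\<rbrakk> \<Longrightarrow> padd P a (zero P) = Some a"
  unfolding partial_abelian_monoid_def by blast

lemma pam_assoc:
  assumes "partial_abelian_monoid P" "padd P b c = Some d" "padd P a d = Some e"
    and "a \<in> carrier P" "b \<in> carrier P" "c \<in> carrier P"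
  obtains s where "padd P a b = Some s" "padd P s c = Some e"
  using assms unfolding partial_abelian_monoid_def by blast

lemma pam_zero_add: "\<lbrakk>partial_abelian_monoid P; a \<in> carrier P\<rbrakk> \<Longrightarrow> padd P (zero P) a = Some a"
  by (blast intro: pam_commute pam_add_zero pam_zero_carrier)

text \<open>
  (P1) moves brackets to the left only; the other direction is the same law read for the sum in
  reverse order, \<open>c + (b + a)\<close>.
\<close>

lemma pam_assoc_right:
  assumes P: "partial_abelian_monoid P" and ab: "padd P a b = Some d" and dc: "padd P d c = Some e"
    and car: "a \<in> carrier P" "b \<in> carrier P" "c \<in> carrier P"
  obtains s where "padd P b c = Some s" "padd P a s = Some e"
proof -
  have "d \<in> carrier P" using pam_sum_carrier[OF P ab] car by blast
  then have ba: "padd P b a = Some d" and cd: "padd P c d = Some e"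
    using pam_commute[OF P ab] pam_commute[OF P dc] car by blast+
  obtain s where s: "padd P c b = Some s" "padd P s a = Some e"
    using pam_assoc[OF P ba cd] car by blast
  then have "s \<in> carrier P" using pam_sum_carrier[OF P] car by blast
  with s show thesis using that pam_commute[OF P] car by blast
qed

lemma pam_rel_monoid_simps [simp]:
  "elems (pam_rel_monoid P) = carrier P"
  "units (pam_rel_monoid P) = {zero P}"
  "((a, b), c) \<in> mult (pam_rel_monoid P) \<longleftrightarrow>
     a \<in> carrier P \<and> b \<in> carrier P \<and> c \<in> carrier P \<and> padd P a b = Some c"
  by (auto simp: pam_rel_monoid_def)

lemma relational_monoid_pam_rel_monoid:
  assumes P: "partial_abelian_monoid P"
  shows "relational_monoid (pam_rel_monoid P)"
proof -
  have assoc: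
    "(\<exists>w\<in>carrier P. padd P a b = Some w \<and> padd P w c = Some z) \<longleftrightarrow>
     (\<exists>w\<in>carrier P. padd P b c = Some w \<and> padd P a w = Some z)"
    if car: "a \<in> carrier P" "b \<in> carrier P" "c \<in> carrier P" for a b c z
  proof
    assume "\<exists>w\<in>carrier P. padd P a b = Some w \<and> padd P w c = Some z"
    then obtain w where "padd P a b = Some w" "padd P w c = Some z" by blast
    with P obtain s where s: "padd P b c = Some s" "padd P a s = Some z"
      using car by (rule pam_assoc_right)
    then show "\<exists>w\<in>carrier P. padd P b c = Some w \<and> padd P a w = Some z"
      using pam_sum_carrier[OF P s(1)] car by blast
  next
    assume "\<exists>w\<in>carrier P. padd P b c = Some w \<and> padd P a w = Some z"
    then obtain w where "padd P b c = Some w" "padd P a w = Some z" by blast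
    with P obtain s where s: "padd P a b = Some s" "padd P s c = Some z"
      using car by (rule pam_assoc)
    then show "\<exists>w\<in>carrier P. padd P a b = Some w \<and> padd P w c = Some z"
      using pam_sum_carrier[OF P s(1)] car by blast
  qed
  have "mult (pam_rel_monoid P) \<subseteq> (carrier P \<times> carrier P) \<times> carrier P"
    by auto
  then show ?thesis
    by (simp add: relational_monoid_def assoc pam_zero_carrier[OF P] pam_add_zero[OF P]
        pam_zero_add[OF P])
qed

text \<open>
  (C1), (C2) and (C5), the conditions that make the quotient a partial abelian monoid. The one on
  the class of zero stays outside: it only concerns the unit condition on the right adjoint.
\<close>

locale pam_congruence =
  fixes A :: "'a pam" and r :: "('a \<times> 'a) set"
  assumes pam: "partial_abelian_monoid A"
    and equiv: "equiv (carrier A) r"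
    and sum_cong: "\<lbrakk>padd A x y = Some s; padd A x' y' = Some s'; (x, x') \<in> r; (y, y') \<in> r\<rbrakk>
      \<Longrightarrow> (s, s') \<in> r"
    and sum_lift: "\<lbrakk>padd A x y = Some s; (s, z) \<in> r; x \<in> carrier A; y \<in> carrier A\<rbrakk>
      \<Longrightarrow> \<exists>x' y'. (x', x) \<in> r \<and> (y', y) \<in> r \<and> padd A x' y' = Some z"
begin

abbreviation Q where "Q \<equiv> pam_quotient A r"

lemma rel_carrier: "(x, y) \<in> r \<Longrightarrow> x \<in> carrier A \<and> y \<in> carrier A"
  using equiv by (auto simp: equiv_def refl_on_def)

lemma rel_refl: "x \<in> carrier A \<Longrightarrow> (x, x) \<in> r"
  using equiv by (auto simp: equiv_def refl_on_def)

lemma rel_euclid: "\<lbrakk>(x, y) \<in> r; (x, z) \<in> r\<rbrakk> \<Longrightarrow> (y, z) \<in> r"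
  using equiv by (meson equivE symD transD)

lemma class_eq_iff: "\<lbrakk>x \<in> carrier A; y \<in> carrier A\<rbrakk> \<Longrightarrow> r `` {x} = r `` {y} \<longleftrightarrow> (x, y) \<in> r"
  using eq_equiv_class_iff[OF equiv] .

lemma quotient_simps [simp]:
  "carrier Q = carrier A // r"
  "zero Q = r `` {zero A}"
  by (simp_all add: pam_quotient_def)

text \<open>
  Once some representatives have a sum, (C2) gives the definite description in the quotient sum
  exactly one solution, so the sum can be computed on any representatives that can be added.
\<close>

lemma quotient_sum_iff:
  assumes x: "x \<in> carrier A" and y: "y \<in> carrier A"
  shows "padd Q (r `` {x}) (r `` {y}) = Some Z \<longleftrightarrow>
    (\<exists>x' y' s. (x, x') \<in> r \<and> (y, y') \<in> r \<and> padd A x' y' = Some s \<and> Z = r `` {s})"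
    (is "_ \<longleftrightarrow> ?sum Z")
proof (cases "\<exists>Z. ?sum Z")
  case True
  then obtain x' y' s where s: "(x, x') \<in> r" "(y, y') \<in> r" "padd A x' y' = Some s"
    by blast
  have unique: "W = r `` {s}" if W: "?sum W" for W
  proof -
    obtain u v t where t: "(x, u) \<in> r" "(y, v) \<in> r" "padd A u v = Some t" "W = r `` {t}"
      using W by blast
    have "(u, x') \<in> r" "(v, y') \<in> r"
      using rel_euclid[OF t(1) s(1)] rel_euclid[OF t(2) s(2)] by blast+
    then have "(t, s) \<in> r" using sum_cong[OF t(3) s(3)] by blast
    then show ?thesis using t(4) equiv_class_eq[OF equiv] by simp
  qed
  have the_sum: "(THE Z. \<exists>x'\<in>r `` {x}. \<exists>y'\<in>r `` {y}. \<exists>s. padd A x' y' = Some s \<and> Z = r `` {s})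
      = r `` {s}"
    using s unique by (intro the_equality) blast+
  have "\<exists>x'\<in>r `` {x}. \<exists>y'\<in>r `` {y}. padd A x' y' \<noteq> None"
    using s by auto
  then have "padd Q (r `` {x}) (r `` {y}) = Some (r `` {s})"
    unfolding pam_quotient_def using the_sum by simp
  then show ?thesis using s unique by auto
next
  case False
  then have "\<not> (\<exists>x'\<in>r `` {x}. \<exists>y'\<in>r `` {y}. padd A x' y' \<noteq> None)"
    by blast
  then have "padd Q (r `` {x}) (r `` {y}) = None"
    unfolding pam_quotient_def by simp
  then show ?thesis using False by auto
qed

lemma quotient_sumI:
  assumes "padd A x y = Some s" "x \<in> carrier A" "y \<in> carrier A"
  shows "padd Q (r `` {x}) (r `` {y}) = Some (r `` {s})"
  using assms rel_refl quotient_sum_iff by blast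

lemma quotient_sum_representatives:
  assumes sum: "padd Q X Y = Some Z" and X: "X \<in> carrier Q" and Y: "Y \<in> carrier Q"
  obtains x y s where "x \<in> carrier A" "y \<in> carrier A" "X = r `` {x}" "Y = r `` {y}"
    "padd A x y = Some s" "Z = r `` {s}"
proof -
  obtain x y where x: "x \<in> carrier A" "X = r `` {x}" and y: "y \<in> carrier A" "Y = r `` {y}"
    using X Y by (auto elim!: quotientE)
  obtain x' y' s where s: "(x, x') \<in> r" "(y, y') \<in> r" "padd A x' y' = Some s" "Z = r `` {s}"
    using sum quotient_sum_iff[OF x(1) y(1)] x(2) y(2) by auto
  have "X = r `` {x'}" "Y = r `` {y'}"
    using x(2) y(2) equiv_class_eq[OF equiv s(1)] equiv_class_eq[OF equiv s(2)] by simp_all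
  then show thesis using that rel_carrier s by blast
qed

lemma quotient_sum_class:
  assumes "padd Q X Y = Some Z" "X \<in> carrier Q" "Y \<in> carrier Q"
  shows "Z \<in> carrier Q"
  using assms
proof (rule quotient_sum_representatives)
  fix x y s assume "x \<in> carrier A" "y \<in> carrier A" "padd A x y = Some s" "Z = r `` {s}"
  then show ?thesis using pam_sum_carrier[OF pam] by (simp add: quotientI)
qed

text \<open>
  (C5) on the level of the quotient: every prescribed representative of a sum of classes is a sum
  of representatives.
\<close>

lemma quotient_sumE:
  assumes sum: "padd Q X Y = Some Z" and X: "X \<in> carrier Q" and Y: "Y \<in> carrier Q"
    and z: "z \<in> Z"
  obtains x y where "x \<in> carrier A" "y \<in> carrier A" "X = r `` {x}" "Y = r `` {y}"
    "padd A x y = Some z" "Z = r `` {z}"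
proof -
  obtain x y s where xy: "x \<in> carrier A" "y \<in> carrier A" "X = r `` {x}" "Y = r `` {y}"
      and s: "padd A x y = Some s" "Z = r `` {s}"
    using sum X Y by (rule quotient_sum_representatives)
  have sz: "(s, z) \<in> r" using z s by blast
  obtain x' y' where x'y': "(x', x) \<in> r" "(y', y) \<in> r" "padd A x' y' = Some z"
    using sum_lift[OF s(1) sz xy(1,2)] by blast
  have "X = r `` {x'}" "Y = r `` {y'}" "Z = r `` {z}"
    using xy(3,4) s(2) equiv_class_eq[OF equiv x'y'(1)] equiv_class_eq[OF equiv x'y'(2)]
      equiv_class_eq[OF equiv sz] by simp_all
  then show thesis using that rel_carrier x'y' by blast
qed

lemma class_nonempty: "X \<in> carrier Q \<Longrightarrow> \<exists>x. x \<in> X"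
  using in_quotient_imp_non_empty[OF equiv] by auto

lemma partial_abelian_monoid_quotient: "partial_abelian_monoid Q"
  unfolding partial_abelian_monoid_def
proof (intro conjI ballI allI impI)
  show "zero Q \<in> carrier Q" by (simp add: quotientI pam_zero_carrier[OF pam])
next
  fix X Y Z assume "X \<in> carrier Q" "Y \<in> carrier Q" "padd Q X Y = Some Z"
  then show "Z \<in> carrier Q" using quotient_sum_class by blast
next
  fix X Y Z D E
  assume car: "X \<in> carrier Q" "Y \<in> carrier Q" "Z \<in> carrier Q"
    and sums: "padd Q Y Z = Some D \<and> padd Q X D = Some E"
  then have D: "D \<in> carrier Q" using quotient_sum_class by blast
  then have "E \<in> carrier Q" using sums car quotient_sum_class by blast
  then obtain e where e: "e \<in> E" using class_nonempty by blast
  have YZ: "padd Q Y Z = Some D" and XD: "padd Q X D = Some E"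
    using sums by auto
  obtain x d where x: "x \<in> carrier A" "X = r `` {x}" and d: "d \<in> carrier A" "D = r `` {d}"
      and xd: "padd A x d = Some e" and E: "E = r `` {e}"
    using XD car(1) D e by (rule quotient_sumE)
  \<comment> \<open>Here \<open>d\<close> is whatever representative of \<open>D\<close> can be added to \<open>x\<close>; it has to be split.\<close>
  have "d \<in> D" using d rel_refl by blast
  with YZ car(2,3) obtain y z where y: "y \<in> carrier A" and z: "z \<in> carrier A"
      and Y: "Y = r `` {y}" and Z: "Z = r `` {z}" and yz: "padd A y z = Some d"
    by (rule quotient_sumE)
  obtain s where s: "padd A x y = Some s" "padd A s z = Some e"
    using pam yz xd x(1) y z by (rule pam_assoc)
  have "s \<in> carrier A" using pam_sum_carrier[OF pam s(1) x(1) y] .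
  then show "\<exists>S. padd Q X Y = Some S \<and> padd Q S Z = Some E"
    unfolding x(2) Y Z E
    using quotient_sumI[OF s(1) x(1) y] quotient_sumI[OF s(2) _ z] by blast
next
  fix X Y Z assume "X \<in> carrier Q" "Y \<in> carrier Q" "padd Q X Y = Some Z"
  then obtain x y z where x: "x \<in> carrier A" "X = r `` {x}" and y: "y \<in> carrier A" "Y = r `` {y}"
      and z: "padd A x y = Some z" "Z = r `` {z}"
    using quotient_sum_representatives[of X Y Z thesis] by blast
  show "padd Q Y X = Some Z"
    unfolding x(2) y(2) z(2)
    using quotient_sumI[OF pam_commute[OF pam z(1) x(1) y(1)] y(1) x(1)] .
next
  fix X assume "X \<in> carrier Q"
  then obtain x where "x \<in> carrier A" "X = r `` {x}" by (auto elim!: quotientE)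
  then show "padd Q X (zero Q) = Some X"
    using quotient_sumI[OF pam_add_zero[OF pam]] pam_zero_carrier[OF pam] by simp
qed

lemma quotient_map_iff: "(x, X) \<in> quotient_map A r \<longleftrightarrow> x \<in> carrier A \<and> X = r `` {x}"
  by (auto simp: quotient_map_def)

lemma quotient_map_morphism:
  "relmon_morphism (pam_rel_monoid A) (pam_rel_monoid Q) (quotient_map A r)"
  unfolding relmon_morphism_def
  using relational_monoid_pam_rel_monoid[OF pam]
    relational_monoid_pam_rel_monoid[OF partial_abelian_monoid_quotient]
  by (auto simp: quotient_map_iff quotientI quotient_sumI)

text \<open>
  The converse of the quotient map relates a class to all its elements, and a morphism must split
  each of them along a given decomposition of the class: this is \<open>quotient_sumE\<close>. The
  assumption on the class of zero is the unit condition.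
\<close>

lemma converse_quotient_map_morphism:
  assumes zero_class: "\<And>x. (x, zero A) \<in> r \<Longrightarrow> x = zero A"
  shows "relmon_morphism (pam_rel_monoid Q) (pam_rel_monoid A) ((quotient_map A r)\<inverse>)"
proof -
  have split: "\<exists>x\<in>carrier A. \<exists>y\<in>carrier A. X = r `` {x} \<and> Y = r `` {y} \<and> padd A x y = Some z"
    if "X \<in> carrier Q" "Y \<in> carrier Q" "padd Q X Y = Some (r `` {z})" "z \<in> carrier A" for X Y z
  proof -
    have "z \<in> r `` {z}" using that(4) rel_refl by blast
    with that(3,1,2) obtain x y where "x \<in> carrier A" "y \<in> carrier A"
        "X = r `` {x}" "Y = r `` {y}" "padd A x y = Some z"
      by (rule quotient_sumE)
    then show ?thesis by blast
  qed
  have "x = zero A" if "x \<in> carrier A" "r `` {zero A} = r `` {x}" for x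
    using that zero_class class_eq_iff pam_zero_carrier[OF pam] by metis
  then show ?thesis
    unfolding relmon_morphism_def
    using relational_monoid_pam_rel_monoid[OF pam] split
      relational_monoid_pam_rel_monoid[OF partial_abelian_monoid_quotient]
    by (auto simp: quotient_map_iff quotientI)
qed

lemma kernel_quotient_map: "quotient_map A r O (quotient_map A r)\<inverse> = r"
  using class_eq_iff rel_carrier by (auto simp: quotient_map_iff relcomp_unfold)

end

theorem proposition6:
  fixes A :: "'a pam" and r :: "('a \<times> 'a) set"
  assumes pam: "partial_abelian_monoid A"
    and rel: "r \<subseteq> carrier A \<times> carrier A"
    and C1: "equiv (carrier A) r"
    and C2: "\<forall>x\<^sub>1\<in>carrier A. \<forall>x\<^sub>2\<in>carrier A. \<forall>y\<^sub>1\<in>carrier A. \<forall>y\<^sub>2\<in>carrier A. \<forall>s\<^sub>1 s\<^sub>2.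
        padd A x\<^sub>1 y\<^sub>1 = Some s\<^sub>1 \<and> padd A x\<^sub>2 y\<^sub>2 = Some s\<^sub>2 \<and> (x\<^sub>1, x\<^sub>2) \<in> r \<and> (y\<^sub>1, y\<^sub>2) \<in> r
        \<longrightarrow> (s\<^sub>1, s\<^sub>2) \<in> r"
    and C5: "\<forall>x\<in>carrier A. \<forall>y\<in>carrier A. \<forall>z\<in>carrier A. \<forall>s.
        padd A x y = Some s \<and> (s, z) \<in> r
        \<longrightarrow> (\<exists>x\<^sub>1\<in>carrier A. \<exists>y\<^sub>1\<in>carrier A.
              (x\<^sub>1, x) \<in> r \<and> (y\<^sub>1, y) \<in> r \<and> padd A x\<^sub>1 y\<^sub>1 = Some z)"
    and zero_class: "\<forall>x\<in>carrier A. (x, zero A) \<in> r \<longrightarrow> x = zero A"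
  shows "relmon_left_adjoint (pam_rel_monoid A) (pam_rel_monoid (pam_quotient A r))
           (quotient_map A r)
         \<and> r = quotient_map A r O (quotient_map A r)\<inverse>"
proof -
  interpret pam_congruence A r
  proof
    show "partial_abelian_monoid A" "equiv (carrier A) r" by fact+
  next
    fix x y s x' y' s'
    assume "padd A x y = Some s" "padd A x' y' = Some s'" "(x, x') \<in> r" "(y, y') \<in> r"
    then show "(s, s') \<in> r" using C2 rel by blast
  next
    fix x y s z
    assume "padd A x y = Some s" "(s, z) \<in> r" "x \<in> carrier A" "y \<in> carrier A"
    then show "\<exists>x' y'. (x', x) \<in> r \<and> (y', y) \<in> r \<and> padd A x' y' = Some z"
      using C5 rel by blast
  qed
  have "x = zero A" if "(x, zero A) \<in> r" for x
    using that zero_class rel by blast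
  then have "relmon_morphism (pam_rel_monoid Q) (pam_rel_monoid A) ((quotient_map A r)\<inverse>)"
    by (rule converse_quotient_map_morphism)
  moreover have "Id_on (carrier A) \<subseteq> quotient_map A r O (quotient_map A r)\<inverse>"
    by (auto simp: quotient_map_iff)
  moreover have "(quotient_map A r)\<inverse> O quotient_map A r \<subseteq> Id_on (carrier Q)"
    by (auto simp: quotient_map_iff quotientI)
  ultimately have "relmon_left_adjoint (pam_rel_monoid A) (pam_rel_monoid Q) (quotient_map A r)"
    using quotient_map_morphism unfolding relmon_left_adjoint_def by auto
  then show ?thesis using kernel_quotient_map by simp
qed

end
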